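(* There exists a constant $C>0$ and a polynomial-time algorithm which, given an $n$-point metric space $\mathcal{X}=(X,\rho)$, $\varepsilon\ge 0$ and $k\ge 0$ such that $\mathcal{X}$ admits an $(\varepsilon,k)$-outlier embedding into an ultrametric, outputs a $(C\varepsilon\log n,\,3k)$-outlier embedding of $\mathcal{X}$ into an ultrametric; i.e. it outputs a set $\mathcal{O}\subseteq X$ with $|\mathcal{O}|\le 3k$ and an ultrametric $\delta$ on $X\setminus\mathcal{O}$ with $|\rho(x,y)-\delta(x,y)|\le C\varepsilon\log n\cdot\mathrm{diam}(\mathcal{X})$ for all $x,y\in X\setminus\mathcal{O}$.
   Context: An ultrametric is a metric space $(Y,\rho')$ with $\rho'(x,y)\le\max\{\rho'(x,z),\rho'(z,y)\}$ for all $x,y,z$. For a finite metric space $\mathcal{X}=(X,\rho)$, $\mathrm{diam}(\mathcal{X})=\max_{x,y\in X}\rho(x,y)$. $\mathcal{X}$ admits an $(\varepsilon,k)$-outlier embedding into a target class if there exist $\mathcal{O}\subseteq X$ with $|\mathcal{O}|\le k$, a space $(Y,\rho')$ in the class, and a map $f:X\setminus\mathcal{O}\to Y$ with $\sup_{x,y\in X\setminus\mathcal{O}}|\rho(x,y)-\rho'(f(x),f(y))|\le\varepsilon\,\mathrm{diam}(\mathcal{X})$. *)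

theory Defs
  imports "HOL-Analysis.Analysis" "HOL-Computational_Algebra.Polynomial"
begin

section \<open>Ultrametrics and outlier embeddings\<close>

definition ultrametric_space :: "'a set \<Rightarrow> ('a \<Rightarrow> 'a \<Rightarrow> real) \<Rightarrow> bool" where
  "ultrametric_space Y d \<longleftrightarrow>
     Metric_space Y d \<and> (\<forall>x\<in>Y. \<forall>y\<in>Y. \<forall>z\<in>Y. d x y \<le> max (d x z) (d z y))"

definition finite_diam :: "'a set \<Rightarrow> ('a \<Rightarrow> 'a \<Rightarrow> real) \<Rightarrow> real" where
  "finite_diam X d = Max {d x y | x y. x \<in> X \<and> y \<in> X}"

text \<open>The bound on the supremum of the distortions is written pointwise, so that it is also
  meaningful when every point is an outlier.\<close>

definition outlier_embedding ::
  "'a set \<Rightarrow> ('a \<Rightarrow> 'a \<Rightarrow> real) \<Rightarrow> real \<Rightarrow> nat \<Rightarrow> 'a set \<Rightarrow> 'b set \<Rightarrow> ('b \<Rightarrow> 'b \<Rightarrow> real) \<Rightarrow> ('a \<Rightarrow> 'b) \<Rightarrow> bool"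
  where
  "outlier_embedding X \<rho> \<epsilon> k S Y \<rho>' f \<longleftrightarrow>
     S \<subseteq> X \<and> card S \<le> k \<and> f \<in> (X - S) \<rightarrow> Y \<and>
     (\<forall>x\<in>X - S. \<forall>y\<in>X - S. \<bar>\<rho> x y - \<rho>' (f x) (f y)\<bar> \<le> \<epsilon> * finite_diam X \<rho>)"

text \<open>HOL cannot quantify over the type of the points of the target space, so the target is
  taken to be a set of natural numbers. For finite \<open>X\<close> this is no restriction, by
  \<open>admits_outlier_embedding_ultrametricI\<close> below.\<close>

definition admits_outlier_embedding_ultrametric ::
  "'a set \<Rightarrow> ('a \<Rightarrow> 'a \<Rightarrow> real) \<Rightarrow> real \<Rightarrow> nat \<Rightarrow> bool" where
  "admits_outlier_embedding_ultrametric X \<rho> \<epsilon> k \<longleftrightarrow>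
     (\<exists>S (Y :: nat set) \<rho>' f. ultrametric_space Y \<rho>' \<and> outlier_embedding X \<rho> \<epsilon> k S Y \<rho>' f)"

lemma admits_outlier_embedding_ultrametricI:
  fixes Y :: "'b set"
  assumes fin: "finite X" and ult: "ultrametric_space Y \<rho>'"
    and emb: "outlier_embedding X \<rho> \<epsilon> k S Y \<rho>' f"
  shows "admits_outlier_embedding_ultrametric X \<rho> \<epsilon> k"
proof -
  define Z where "Z = f ` (X - S)"
  have Z: "finite Z" "Z \<subseteq> Y"
    using fin emb by (auto simp: Z_def outlier_embedding_def)
  obtain g :: "'b \<Rightarrow> nat" where g: "inj_on g Z"
    using finite_imp_inj_to_nat_seg[OF Z(1)] by blast
  define h where "h = inv_into Z g"
  have hg: "h (g z) = z" if "z \<in> Z" for z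
    using g that by (simp add: h_def)
  define d where "d = (\<lambda>a b. \<rho>' (h a) (h b))"
  interpret Metric_space Y \<rho>'
    using ult by (simp add: ultrametric_space_def)
  have "Metric_space (g ` Z) d"
  proof
    fix x y z
    show "0 \<le> d x y" "d x y = d y x" by (simp_all add: d_def commute)
    show "d x y = 0 \<longleftrightarrow> x = y" if "x \<in> g ` Z" "y \<in> g ` Z"
      using that Z(2) hg by (auto simp: d_def subset_iff)
    show "d x z \<le> d x y + d y z" if "x \<in> g ` Z" "y \<in> g ` Z" "z \<in> g ` Z"
      using that Z(2) hg triangle by (auto simp: d_def subset_iff)
  qed
  moreover have "\<forall>x\<in>g ` Z. \<forall>y\<in>g ` Z. \<forall>z\<in>g ` Z. d x y \<le> max (d x z) (d z y)"
    using ult Z(2) hg by (auto simp: d_def ultrametric_space_def subset_iff)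
  ultimately have "ultrametric_space (g ` Z) d"
    by (simp add: ultrametric_space_def)
  moreover have "outlier_embedding X \<rho> \<epsilon> k S (g ` Z) d (g \<circ> f)"
    using emb hg by (auto simp: outlier_embedding_def d_def Z_def)
  ultimately show ?thesis
    unfolding admits_outlier_embedding_ultrametric_def by blast
qed

section \<open>A real random access machine\<close>

text \<open>Inputs are real distance matrices, so running time is measured on a unit-cost real RAM:
  registers and indirectly addressed memory for natural numbers and for reals, where a real is only
  accessible through field operations and comparisons. To keep the unit cost reasonable, natural
  numbers can be added and subtracted but not multiplied, there is no conversion (such as rounding)
  between the two sorts, and the only real constants in programs are natural numbers.\<close>

record machine =
  ireg :: "nat \<Rightarrow> nat"
  imem :: "nat \<Rightarrow> nat"
  rreg :: "nat \<Rightarrow> real"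
  rmem :: "nat \<Rightarrow> real"

datatype instr =
    IConst nat nat
  | IAdd nat nat nat
  | ISub nat nat nat
  | ILoad nat nat
  | IStore nat nat
  | RConst nat nat
  | RAdd nat nat nat
  | RSub nat nat nat
  | RMul nat nat nat
  | RDiv nat nat nat
  | RLoad nat nat
  | RStore nat nat

text \<open>Subtraction of natural numbers is truncated, and division by zero yields zero.\<close>

fun step :: "instr \<Rightarrow> machine \<Rightarrow> machine" where
  "step (IConst i c) s = s\<lparr>ireg := (ireg s)(i := c)\<rparr>"
| "step (IAdd i j l) s = s\<lparr>ireg := (ireg s)(i := ireg s j + ireg s l)\<rparr>"
| "step (ISub i j l) s = s\<lparr>ireg := (ireg s)(i := ireg s j - ireg s l)\<rparr>"
| "step (ILoad i a) s = s\<lparr>ireg := (ireg s)(i := imem s (ireg s a))\<rparr>"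
| "step (IStore a i) s = s\<lparr>imem := (imem s)(ireg s a := ireg s i)\<rparr>"
| "step (RConst r c) s = s\<lparr>rreg := (rreg s)(r := real c)\<rparr>"
| "step (RAdd r u v) s = s\<lparr>rreg := (rreg s)(r := rreg s u + rreg s v)\<rparr>"
| "step (RSub r u v) s = s\<lparr>rreg := (rreg s)(r := rreg s u - rreg s v)\<rparr>"
| "step (RMul r u v) s = s\<lparr>rreg := (rreg s)(r := rreg s u * rreg s v)\<rparr>"
| "step (RDiv r u v) s = s\<lparr>rreg := (rreg s)(r := rreg s u / rreg s v)\<rparr>"
| "step (RLoad r a) s = s\<lparr>rreg := (rreg s)(r := rmem s (ireg s a))\<rparr>"
| "step (RStore a r) s = s\<lparr>rmem := (rmem s)(ireg s a := rreg s r)\<rparr>"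

datatype test = ILess nat nat | RLess nat nat

fun holds :: "test \<Rightarrow> machine \<Rightarrow> bool" where
  "holds (ILess i j) s \<longleftrightarrow> ireg s i < ireg s j"
| "holds (RLess u v) s \<longleftrightarrow> rreg s u < rreg s v"

datatype program =
    Skip
  | Instr instr
  | Seq program program
  | Cond test program program
  | While test program

text \<open>\<open>runs P s t s'\<close>: started in \<open>s\<close>, the program \<open>P\<close> halts in \<open>s'\<close> after executing exactly
  \<open>t\<close> instructions and tests.\<close>

inductive runs :: "program \<Rightarrow> machine \<Rightarrow> nat \<Rightarrow> machine \<Rightarrow> bool" where
  runs_Skip: "runs Skip s 0 s"
| runs_Instr: "runs (Instr a) s 1 (step a s)"
| runs_Seq: "runs P s t s' \<Longrightarrow> runs Q s' t' s'' \<Longrightarrow> runs (Seq P Q) s (t + t') s''"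
| runs_Cond_True: "holds b s \<Longrightarrow> runs P s t s' \<Longrightarrow> runs (Cond b P Q) s (Suc t) s'"
| runs_Cond_False: "\<not> holds b s \<Longrightarrow> runs Q s t s' \<Longrightarrow> runs (Cond b P Q) s (Suc t) s'"
| runs_While_False: "\<not> holds b s \<Longrightarrow> runs (While b P) s 1 s"
| runs_While_True: "holds b s \<Longrightarrow> runs P s t s' \<Longrightarrow> runs (While b P) s' t' s'' \<Longrightarrow>
    runs (While b P) s (Suc (t + t')) s''"

inductive_cases runs_SkipE: "runs Skip s t s'"
inductive_cases runs_InstrE: "runs (Instr a) s t s'"
inductive_cases runs_SeqE: "runs (Seq P Q) s t s'"
inductive_cases runs_CondE: "runs (Cond b P Q) s t s'"
inductive_cases runs_WhileE: "runs (While b P) s t s'"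

lemma runs_deterministic:
  "runs P s t s' \<Longrightarrow> runs P s u s'' \<Longrightarrow> u = t \<and> s'' = s'"
proof (induction arbitrary: u s'' rule: runs.induct)
  case (runs_Skip s)
  then show ?case by (auto elim: runs_SkipE)
next
  case (runs_Instr a s)
  then show ?case by (auto elim: runs_InstrE)
next
  case (runs_Seq P s t s' Q t' s2)
  show ?case
    by (rule runs_SeqE[OF runs_Seq.prems]) (use runs_Seq.IH in blast)
next
  case (runs_Cond_True b s P t s' Q)
  show ?case
    by (rule runs_CondE[OF runs_Cond_True.prems]) (use runs_Cond_True.hyps runs_Cond_True.IH in blast)+
next
  case (runs_Cond_False b s Q t s' P)
  show ?case
    by (rule runs_CondE[OF runs_Cond_False.prems]) (use runs_Cond_False.hyps runs_Cond_False.IH in blast)+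
next
  case (runs_While_False b s P)
  show ?case
    by (rule runs_WhileE[OF runs_While_False.prems]) (use runs_While_False.hyps in simp_all)
next
  case (runs_While_True b s P t s' t' s2)
  show ?case
    by (rule runs_WhileE[OF runs_While_True.prems]) (use runs_While_True.hyps runs_While_True.IH in blast)+
qed

section \<open>Encoding of instances and solutions\<close>

text \<open>An instance on the points \<open>{..<n}\<close> is given by its distance matrix, stored row by row;
  \<open>n\<close>, \<open>k\<close> and \<open>\<epsilon>\<close> are in registers, and everything else is zero.\<close>

definition input_state :: "nat \<Rightarrow> (nat \<Rightarrow> nat \<Rightarrow> real) \<Rightarrow> real \<Rightarrow> nat \<Rightarrow> machine" where
  "input_state n \<rho> \<epsilon> k =
     \<lparr>ireg = (\<lambda>_. 0)(0 := n, 1 := k),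
      imem = (\<lambda>_. 0),
      rreg = (\<lambda>_. 0)(0 := \<epsilon>),
      rmem = (\<lambda>a. if a < n * n then \<rho> (a div n) (a mod n) else 0)\<rparr>"

definition output_outliers :: "nat \<Rightarrow> machine \<Rightarrow> nat set" where
  "output_outliers n s = {x. x < n \<and> imem s x \<noteq> 0}"

text \<open>The values outside the surviving points are fixed to zero because \<open>Metric_space\<close> demands
  nonnegativity and symmetry on the whole type.\<close>

definition output_dist :: "nat \<Rightarrow> machine \<Rightarrow> nat \<Rightarrow> nat \<Rightarrow> real" where
  "output_dist n s x y =
     (if x \<in> {..<n} - output_outliers n s \<and> y \<in> {..<n} - output_outliers n s
      then rmem s (n * x + y) else 0)"

end

theory Submission
  imports Defs
begin

text \<open>Put \<open>D = 2 * \<epsilon> * diam\<close>. Any three points that survive in the given embedding satisfy the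
  ultrametric inequality up to \<open>D\<close>, so every triple violating it by more than \<open>D\<close> contains an
  outlier. Greedily deleting disjoint violating triples hence deletes at most \<open>3 * k\<close> points. On the
  remaining points take the minimax path distance \<open>d\<close>, the largest ultrametric below \<open>\<rho>\<close>, computed
  as by Floyd and Warshall. A path from \<open>x\<close> to \<open>y\<close> whose edges have length at most \<open>d x y\<close> is halved
  recursively; every halving costs an additive error of \<open>D\<close>, so that
  \<open>\<rho> x y \<le> d x y + O(log n) * D\<close>.\<close>

section \<open>Ultrametrics up to an additive error\<close>

text \<open>Cutting a path of at most \<open>2 ^ Suc j\<close> edges in the middle leaves two paths
  of at most \<open>2 ^ j\<close> edges. The hypothesis at the cut point takes the maximum of the
  two bounds, so each level of halving adds \<open>D\<close> only once.\<close>

lemma relpow_almost_ultrametric: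
  fixes \<rho> :: "'a \<Rightarrow> 'a \<Rightarrow> real"
  assumes almost: "\<And>x y z. x \<in> S \<Longrightarrow> y \<in> S \<Longrightarrow> z \<in> S \<Longrightarrow> \<rho> x y \<le> max (\<rho> x z) (\<rho> z y) + D"
    and refl: "\<And>x. x \<in> S \<Longrightarrow> \<rho> x x \<le> t" and "D \<ge> 0"
  shows "(x, y) \<in> {(u, v) \<in> S \<times> S. \<rho> u v \<le> t} ^^ m \<Longrightarrow> x \<in> S \<Longrightarrow> m \<le> 2 ^ j \<Longrightarrow>
    y \<in> S \<and> \<rho> x y \<le> t + real j * D"
proof (induction j arbitrary: x y m)
  case 0
  then consider "m = 0" | "m = 1" by fastforce
  then show ?case using 0 refl by cases auto
next
  case (Suc j)
  define a b where "a = m div 2" and "b = m - m div 2"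
  have "m = a + b" "a \<le> 2 ^ j" "b \<le> 2 ^ j" using Suc.prems(3) by (auto simp: a_def b_def)
  then obtain z where "(x, z) \<in> {(u, v) \<in> S \<times> S. \<rho> u v \<le> t} ^^ a"
    "(z, y) \<in> {(u, v) \<in> S \<times> S. \<rho> u v \<le> t} ^^ b"
    using Suc.prems(1) by (auto simp: relpow_add)
  then have "z \<in> S \<and> \<rho> x z \<le> t + real j * D" "z \<in> S \<Longrightarrow> y \<in> S \<and> \<rho> z y \<le> t + real j * D"
    using Suc.IH Suc.prems(2) \<open>a \<le> 2 ^ j\<close> \<open>b \<le> 2 ^ j\<close> by blast+
  then show ?case using almost[of x y z] Suc.prems(2) by (auto simp: algebra_simps)
qed

lemma rtrancl_almost_ultrametric:
  fixes \<rho> :: "'a \<Rightarrow> 'a \<Rightarrow> real"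
  assumes almost: "\<And>x y z. x \<in> S \<Longrightarrow> y \<in> S \<Longrightarrow> z \<in> S \<Longrightarrow> \<rho> x y \<le> max (\<rho> x z) (\<rho> z y) + D"
    and refl: "\<And>x. x \<in> S \<Longrightarrow> \<rho> x x \<le> t" and "D \<ge> 0"
    and "finite S" "card S \<le> n" "n \<ge> 1"
    and path: "(x, y) \<in> {(u, v) \<in> S \<times> S. \<rho> u v \<le> t}\<^sup>*" and "x \<in> S"
  shows "\<rho> x y \<le> t + 4 * log 2 (real n) * D"
proof -
  let ?R = "{(u, v) \<in> S \<times> S. \<rho> u v \<le> t}"
  \<comment> \<open>A shortest path has at most \<open>card ?R \<le> n\<^sup>2\<close> edges, so \<open>2 * L\<close> halvings suffice.\<close>
  define L where "L = nat \<lceil>log 2 (real n)\<rceil>"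
  have fin: "finite ?R" by (rule finite_subset[of _ "S \<times> S"]) (auto simp: \<open>finite S\<close>)
  obtain m where m: "(x, y) \<in> ?R ^^ m" "m \<le> card ?R"
    using path unfolding rtrancl_finite_eq_relpow[OF fin] by blast
  have log0: "log 2 (real n) \<ge> 0" using \<open>n \<ge> 1\<close> by simp
  have "real n = 2 powr log 2 (real n)" using \<open>n \<ge> 1\<close> by simp
  also have "\<dots> \<le> 2 powr real L"
    using log0 by (intro powr_mono) (auto simp: L_def)
  also have "\<dots> = real (2 ^ L)" by (simp add: powr_realpow)
  finally have nL: "n \<le> 2 ^ L" by linarith
  have "card ?R \<le> card (S \<times> S)"
    by (rule card_mono) (auto simp: \<open>finite S\<close>)
  also have "\<dots> \<le> 2 ^ L * 2 ^ L"
    unfolding card_cartesian_product using \<open>card S \<le> n\<close> nL by (intro mult_mono) auto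
  also have "\<dots> = 2 ^ (2 * L)" by (simp add: mult_2 power_add)
  finally have "\<rho> x y \<le> t + real (2 * L) * D"
    using relpow_almost_ultrametric[OF almost refl \<open>D \<ge> 0\<close> m(1) \<open>x \<in> S\<close>, of "2 * L"] m(2) by auto
  \<comment> \<open>Rounding up costs at most 1, which \<open>log 2 n \<ge> 1\<close> absorbs once
    \<open>n \<ge> 2\<close>; at \<open>n = 1\<close> both sides vanish.\<close>
  moreover have "real (2 * L) \<le> 4 * log 2 (real n)"
  proof (cases "n = 1")
    case False
    then have "log 2 (real n) \<ge> 1" using \<open>n \<ge> 1\<close> by simp
    then show ?thesis unfolding L_def by linarith
  qed (simp add: L_def)
  then have "real (2 * L) * D \<le> 4 * log 2 (real n) * D"
    using \<open>D \<ge> 0\<close> by (rule mult_right_mono)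
  ultimately show ?thesis by linarith
qed

section \<open>The algorithm on an abstract state\<close>

text \<open>A state consists of the set of outliers, the current distances, and a threshold.\<close>

type_synonym state = "nat set \<times> (nat \<Rightarrow> nat \<Rightarrow> real) \<times> real"

text \<open>All passes take an index \<open>(z, x, y)\<close>, so that one triple loop serves them
  all.\<close>

fun diam_step :: "nat \<times> nat \<times> nat \<Rightarrow> state \<Rightarrow> state" where
  "diam_step (z, x, y) (M, d, D) = (M, d, max D (d x y))"

text \<open>Which point of a violating triple is at fault is not known, so all three are deleted;
  this is the source of the factor 3.\<close>

fun mark_step :: "nat \<times> nat \<times> nat \<Rightarrow> state \<Rightarrow> state" where
  "mark_step (z, x, y) (M, d, D) =
    (if x \<notin> M \<and> y \<notin> M \<and> z \<notin> M \<and> d x z + D < d x y \<and> d z y + D < d x y then {x, y, z} \<union> M else M, d, D)"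

fun relax_step :: "nat \<times> nat \<times> nat \<Rightarrow> state \<Rightarrow> state" where
  "relax_step (z, x, y) (M, d, D) =
    (M, if x \<notin> M \<and> y \<notin> M \<and> z \<notin> M
        then d(x := (d x)(y := min (d x y) (max (d x z) (d z y)))) else d, D)"

definition pairs :: "nat \<Rightarrow> (nat \<times> nat) list" where
  "pairs n = List.product [0..<n] [0..<n]"

text \<open>The pivot \<open>z\<close> is outermost, as the relaxation in the style of Floyd and
  Warshall requires.\<close>

definition triples :: "nat \<Rightarrow> (nat \<times> nat \<times> nat) list" where
  "triples n = List.product [0..<n] (pairs n)"

lemma set_pairs: "set (pairs n) = {..<n} \<times> {..<n}"
  by (auto simp: pairs_def)

lemma set_triples: "set (triples n) = {..<n} \<times> {..<n} \<times> {..<n}"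
  by (auto simp: triples_def set_pairs)

lemma fold_product: "fold f (List.product xs ys) = fold (\<lambda>x. fold (\<lambda>y. f (x, y)) ys) xs"
  by (induction xs) (simp_all add: fold_map comp_def)

lemma fold_triples:
  "fold f (triples n) =
    fold (\<lambda>z. fold (\<lambda>x. fold (\<lambda>y. f (z, x, y)) [0..<n]) [0..<n]) [0..<n]"
  by (simp add: triples_def pairs_def fold_product)

text \<open>One pass suffices for \<open>P\<close> to hold everywhere: handling \<open>x\<close>
  establishes \<open>P x\<close>, and no later step destroys it.\<close>

lemma fold_invariant_all:
  assumes "I a"
    and "\<And>x a. x \<in> set xs \<Longrightarrow> I a \<Longrightarrow> I (f x a) \<and> P x (f x a)"
    and "\<And>x y a. x \<in> set xs \<Longrightarrow> y \<in> set xs \<Longrightarrow> I a \<Longrightarrow> P x a \<Longrightarrow> P x (f y a)"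
  shows "I (fold f xs a) \<and> (\<forall>x\<in>set xs. P x (fold f xs a))"
proof -
  have "set ys \<subseteq> set xs \<Longrightarrow> I (fold f ys a) \<and> (\<forall>x\<in>set ys. P x (fold f ys a))" for ys
  proof (induction ys rule: rev_induct)
    case (snoc y ys)
    then show ?case using assms(2,3) by simp blast
  qed (simp add: assms(1))
  then show ?thesis by blast
qed

lemma fold_upt_invariant:
  assumes "I 0 a" "\<And>j a. j < n \<Longrightarrow> I j a \<Longrightarrow> I (Suc j) (f j a)"
  shows "I n (fold f [0..<n] a)"
proof -
  have "m \<le> n \<Longrightarrow> I m (fold f [0..<m] a)" for m
    by (induction m) (auto simp: assms)
  then show ?thesis by blast
qed

section \<open>Diameter and greedy deletion\<close>

lemma finite_diam_eq_Max: "finite_diam X d = Max ((\<lambda>(x, y). d x y) ` (X \<times> X))"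
proof -
  have "{d x y | x y. x \<in> X \<and> y \<in> X} = (\<lambda>(x, y). d x y) ` (X \<times> X)" by auto
  then show ?thesis by (simp add: finite_diam_def)
qed

lemma le_finite_diam: "finite X \<Longrightarrow> x \<in> X \<Longrightarrow> y \<in> X \<Longrightarrow> d x y \<le> finite_diam X d"
  unfolding finite_diam_eq_Max by (intro Max_ge) auto

lemma finite_diam_attained:
  assumes "finite X" "X \<noteq> {}"
  obtains x y where "x \<in> X" "y \<in> X" "finite_diam X d = d x y"
proof -
  have "finite_diam X d \<in> (\<lambda>(x, y). d x y) ` (X \<times> X)"
    unfolding finite_diam_eq_Max using assms by (intro Max_in) auto
  then show ?thesis using that by auto
qed

text \<open>The running maximum may start at 0 since distances are nonnegative. The invariant keeps
  it below the diameter, and a pair attaining the diameter bounds it from below.\<close>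

lemma diam_fold:
  assumes "Metric_space {..<n} \<rho>" "n \<ge> 1"
  shows "fold diam_step (triples n) ({}, \<rho>, 0) = ({}, \<rho>, finite_diam {..<n} \<rho>)"
proof -
  interpret Metric_space "{..<n}" \<rho> by fact
  have bound: "\<rho> x y \<le> finite_diam {..<n} \<rho>" if "x < n" "y < n" for x y
    using that by (intro le_finite_diam) auto
  obtain x y where xy: "x < n" "y < n" "finite_diam {..<n} \<rho> = \<rho> x y"
    using finite_diam_attained[of "{..<n}" \<rho>] \<open>n \<ge> 1\<close> by (auto simp: lessThan_empty_iff)
  have "(case fold diam_step (triples n) ({}, \<rho>, 0) of (M, d, D) \<Rightarrow>
      M = {} \<and> d = \<rho> \<and> D \<le> finite_diam {..<n} \<rho>) \<and>
    (\<forall>p\<in>set (triples n). case p of (z, x, y) \<Rightarrow>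
      case fold diam_step (triples n) ({}, \<rho>, 0) of (M, d, D) \<Rightarrow> \<rho> x y \<le> D)"
    by (rule fold_invariant_all) (use bound xy in \<open>auto simp: set_triples max_def\<close>)
  then have "case fold diam_step (triples n) ({}, \<rho>, 0) of (M, d, D) \<Rightarrow>
      M = {} \<and> d = \<rho> \<and> D \<le> finite_diam {..<n} \<rho> \<and> \<rho> x y \<le> D"
    using xy by (force simp: set_triples)
  then show ?thesis using xy by (auto split: prod.splits)
qed

text \<open>Deletions are charged to \<open>S\<close>: points outside \<open>S\<close> never form a
  violating triple, so each deleted triple brings a new point of \<open>S\<close> into
  \<open>M\<close> at the price of at most three deletions.\<close>

lemma mark_fold:
  assumes "S \<subseteq> {..<n}"
    and "\<And>x y z. x \<in> {..<n} - S \<Longrightarrow> y \<in> {..<n} - S \<Longrightarrow> z \<in> {..<n} - S \<Longrightarrow>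
      \<rho> x y \<le> max (\<rho> x z) (\<rho> z y) + D"
  obtains M where "fold mark_step (triples n) ({}, \<rho>, D) = (M, \<rho>, D)"
    and "M \<subseteq> {..<n}" "card M \<le> 3 * card S"
    and "\<And>x y z. x \<in> {..<n} - M \<Longrightarrow> y \<in> {..<n} - M \<Longrightarrow> z \<in> {..<n} - M \<Longrightarrow>
      \<rho> x y \<le> max (\<rho> x z) (\<rho> z y) + D"
proof -
  let ?I = "\<lambda>(M, d, D'). M \<subseteq> {..<n} \<and> d = \<rho> \<and> D' = D \<and> card M \<le> 3 * card (M \<inter> S)"
  let ?P = "\<lambda>(z, x, y) (M, d, D'). x \<notin> M \<and> y \<notin> M \<and> z \<notin> M \<longrightarrow> \<rho> x y \<le> max (\<rho> x z) (\<rho> z y) + D"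
  have finS: "finite S" using assms(1) finite_subset by blast
  have card_step: "card ({x, y, z} \<union> M) \<le> 3 * card (({x, y, z} \<union> M) \<inter> S)"
    if "card M \<le> 3 * card (M \<inter> S)" "x \<notin> M" "y \<notin> M" "z \<notin> M" "x \<in> S \<or> y \<in> S \<or> z \<in> S" for x y z M
  proof -
    have "card ({x, y, z} \<union> M) \<le> card {x, y, z} + card M" by (rule card_Un_le)
    also have "card {x, y, z} \<le> 3" by (simp add: card_insert_if)
    finally have "card ({x, y, z} \<union> M) \<le> 3 + card M" by simp
    \<comment> \<open>The triple is disjoint from \<open>M\<close>, so its point in \<open>S\<close>
      has not been counted before.\<close>
    moreover have "card (M \<inter> S) < card (({x, y, z} \<union> M) \<inter> S)"
      using that by (intro psubset_card_mono) (auto simp: finS)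
    ultimately show ?thesis using that(1) by linarith
  qed
  have "?I (fold mark_step (triples n) ({}, \<rho>, D)) \<and>
    (\<forall>p\<in>set (triples n). ?P p (fold mark_step (triples n) ({}, \<rho>, D)))"
  proof (rule fold_invariant_all, goal_cases)
    case (2 p a)
    obtain z x y where p: "p = (z, x, y)" by (cases p)
    obtain M where a: "a = (M, \<rho>, D)" and M: "M \<subseteq> {..<n}" and card: "card M \<le> 3 * card (M \<inter> S)"
      using 2 by (cases a) auto
    show ?case
    proof (cases "x \<notin> M \<and> y \<notin> M \<and> z \<notin> M \<and> \<rho> x z + D < \<rho> x y \<and> \<rho> z y + D < \<rho> x y")
      case True
      then have "\<not> \<rho> x y \<le> max (\<rho> x z) (\<rho> z y) + D" by linarith
      then have "x \<in> S \<or> y \<in> S \<or> z \<in> S"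
        using assms(2)[of x y z] 2(1) by (auto simp: p set_triples)
      then have "card ({x, y, z} \<union> M) \<le> 3 * card (({x, y, z} \<union> M) \<inter> S)"
        using True card by (intro card_step) auto
      then show ?thesis using True 2 M by (auto simp: p a set_triples)
    next
      case False
      then have "mark_step p a = a" by (auto simp: p a)
      then show ?thesis using False M card by (auto simp: p a)
    qed
  next
    case (3 p q a)
    obtain z x y where p: "p = (z, x, y)" by (cases p)
    obtain M where a: "a = (M, \<rho>, D)" using 3(3) by (cases a) auto
    \<comment> \<open>\<open>?P\<close> constrains only triples outside \<open>M\<close>, and
      \<open>M\<close> only grows, so a settled triple stays settled.\<close>
    define M' where "M' = fst (mark_step q a)"
    have "mark_step q a = (M', \<rho>, D)" "M \<subseteq> M'" by (cases q; auto simp: a M'_def)+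
    then show ?case using 3(4) unfolding p a by auto
  qed simp
  then obtain M where fold: "fold mark_step (triples n) ({}, \<rho>, D) = (M, \<rho>, D)"
    and M: "M \<subseteq> {..<n}" "card M \<le> 3 * card (M \<inter> S)"
    and P: "\<forall>p\<in>set (triples n). ?P p (M, \<rho>, D)"
    by (cases "fold mark_step (triples n) ({}, \<rho>, D)") auto
  show ?thesis
  proof (rule that[OF fold M(1)])
    show "card M \<le> 3 * card S"
      using M(2) card_mono[OF finS, of "M \<inter> S"] by auto
    show "\<rho> x y \<le> max (\<rho> x z) (\<rho> z y) + D" if "x \<in> {..<n} - M" "y \<in> {..<n} - M" "z \<in> {..<n} - M" for x y z
      using bspec[OF P, of "(z, x, y)"] that by (simp add: set_triples)
  qed
qed

section \<open>Minimax distances by relaxation\<close>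

text \<open>Updating in place agrees with updating all pairs at once, because the entries \<open>d x z\<close> and
  \<open>d z y\<close> that are read do not change while \<open>z\<close> is fixed.\<close>

lemma relax_pairs_fold:
  assumes "z < n"
  shows "\<exists>e. fold (\<lambda>p. relax_step (z, p)) (pairs n) (M, d, D) = (M, e, D) \<and>
    (\<forall>x\<in>{..<n} - M. \<forall>y\<in>{..<n} - M.
      e x y = (if z \<in> M then d x y else min (d x y) (max (d x z) (d z y))))"
proof -
  define r where "r x y = (if x \<notin> M \<and> y \<notin> M \<and> z \<notin> M then min (d x y) (max (d x z) (d z y)) else d x y)"
    for x y
  \<comment> \<open>By absorption, \<open>min a (max a b) = a\<close>: the row and the column of
    \<open>z\<close> are fixed, whatever \<open>d z z\<close> is.\<close>
  have rz: "r x z = d x z" "r z x = d z x" for x by (auto simp: r_def)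
  \<comment> \<open>During the pass every entry is either old or final. Relaxing a final entry
    reproduces it, because taking the minimum with the same detour is idempotent.\<close>
  let ?I = "\<lambda>(M', e, D'). M' = M \<and> D' = D \<and> (\<forall>x y. e x y = d x y \<or> e x y = r x y)"
  let ?P = "\<lambda>(x, y) (M', e, D'). e x y = r x y"
  have ez: "e x z = d x z" "e z x = d z x" if "\<forall>x y. e x y = d x y \<or> e x y = r x y" for e x
    using that rz by metis+
  have upd: "min (e x y) (max (e x z) (e z y)) = r x y"
    if e: "\<forall>x y. e x y = d x y \<or> e x y = r x y" and "x \<notin> M" "y \<notin> M" "z \<notin> M" for e x y
  proof -
    have "e x y = d x y \<or> e x y = r x y" using e by blast
    then show ?thesis using that(2-) ez[OF e] by (auto simp: r_def)
  qed
  have "?I (fold (\<lambda>p. relax_step (z, p)) (pairs n) (M, d, D)) \<and>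
    (\<forall>p\<in>set (pairs n). ?P p (fold (\<lambda>p. relax_step (z, p)) (pairs n) (M, d, D)))"
  proof (rule fold_invariant_all, goal_cases)
    case (2 p a)
    obtain x y where p: "p = (x, y)" by (cases p)
    obtain e where a: "a = (M, e, D)" and e: "\<forall>x y. e x y = d x y \<or> e x y = r x y"
      using 2 by (cases a) auto
    show ?case
    proof (cases "x \<notin> M \<and> y \<notin> M \<and> z \<notin> M")
      case True
      then show ?thesis using upd[OF e] e by (simp add: p a)
    next
      case False
      then have "r x y = d x y" by (auto simp: r_def)
      then have "e x y = r x y" using e by metis
      then show ?thesis using False e by (auto simp: p a)
    qed
  next
    case (3 p q a)
    obtain x y where q: "q = (x, y)" by (cases q)
    obtain e where a: "a = (M, e, D)" and e: "\<forall>x y. e x y = d x y \<or> e x y = r x y"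
      using 3 by (cases a) auto
    show ?case
      using 3(4) upd[OF e] by (auto simp: q a)
  qed auto
  then show ?thesis by (auto simp: set_pairs r_def split: prod.splits)
qed

text \<open>Two invariants run along the pivots. \<open>?I\<close> keeps \<open>d\<close> below
  \<open>\<rho>\<close> yet realised by a path with edges of length at most \<open>d x y\<close>;
  these give the two sides of the distortion bound. \<open>?J k\<close> is the ultrametric
  inequality through middle points below \<open>k\<close>, and \<open>?J n\<close> is the full
  one.\<close>

lemma relax_fold:
  fixes \<rho> :: "nat \<Rightarrow> nat \<Rightarrow> real" and M :: "nat set"
  assumes "Metric_space {..<n} \<rho>"
  defines "S \<equiv> {..<n} - M"
  obtains d where "fold relax_step (triples n) (M, \<rho>, D) = (M, d, D)"
    and "\<And>x y. x \<in> S \<Longrightarrow> y \<in> S \<Longrightarrow> d x y = d y x"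
    and "\<And>x y. x \<in> S \<Longrightarrow> y \<in> S \<Longrightarrow> 0 \<le> d x y"
    and "\<And>x y. x \<in> S \<Longrightarrow> y \<in> S \<Longrightarrow> d x y = 0 \<longleftrightarrow> x = y"
    and "\<And>x y. x \<in> S \<Longrightarrow> y \<in> S \<Longrightarrow> d x y \<le> \<rho> x y"
    and "\<And>x y. x \<in> S \<Longrightarrow> y \<in> S \<Longrightarrow> (x, y) \<in> {(u, v) \<in> S \<times> S. \<rho> u v \<le> d x y}\<^sup>*"
    and "\<And>x y z. x \<in> S \<Longrightarrow> y \<in> S \<Longrightarrow> z \<in> S \<Longrightarrow> d x y \<le> max (d x z) (d z y)"
proof -
  interpret Metric_space "{..<n}" \<rho> by fact
  define G where "G t = {(u, v) \<in> S \<times> S. \<rho> u v \<le> t}" for t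
  let ?I = "\<lambda>d. (\<forall>x\<in>S. \<forall>y\<in>S. d x y = d y x \<and> 0 \<le> d x y \<and> (d x y = 0 \<longleftrightarrow> x = y) \<and> d x y \<le> \<rho> x y \<and>
      (x, y) \<in> (G (d x y))\<^sup>*)"
  let ?J = "\<lambda>k d. \<forall>w\<in>S. w < k \<longrightarrow> (\<forall>x\<in>S. \<forall>y\<in>S. d x y \<le> max (d x w) (d w y))"
  let ?f = "\<lambda>z. fold (\<lambda>p. relax_step (z, p)) (pairs n)"
  have step: "?I e \<and> ?J (Suc k) e"
    if I: "?I d" and J: "?J k d" and k: "k \<in> S"
      and e: "\<And>x y. x \<in> S \<Longrightarrow> y \<in> S \<Longrightarrow> e x y = min (d x y) (max (d x k) (d k y))" for k d e
  proof
    show "?I e"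
    proof (intro ballI)
      fix x y assume S: "x \<in> S" "y \<in> S"
      have mono: "(G s)\<^sup>* \<subseteq> (G t)\<^sup>*" if "s \<le> t" for s t
        using that by (intro rtrancl_mono) (auto simp: G_def)
      have "(x, y) \<in> (G (max (d x k) (d k y)))\<^sup>*"
      proof (rule rtrancl_trans)
        show "(x, k) \<in> (G (max (d x k) (d k y)))\<^sup>*"
          by (rule subsetD[OF mono[OF max.cobounded1]]) (use I S k in blast)
        show "(k, y) \<in> (G (max (d x k) (d k y)))\<^sup>*"
          by (rule subsetD[OF mono[OF max.cobounded2]]) (use I S k in blast)
      qed
      moreover have "(x, y) \<in> (G (d x y))\<^sup>*" using I S by blast
      ultimately have path: "(x, y) \<in> (G (e x y))\<^sup>*"
        unfolding e[OF S] min_def by simp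
      have dd: "d x y = d y x" "d x k = d k x" "d k y = d y k" "0 \<le> d x y" "0 \<le> d x k" "0 \<le> d k y"
        "d x y = 0 \<longleftrightarrow> x = y" "d x k = 0 \<longleftrightarrow> x = k" "d k y = 0 \<longleftrightarrow> k = y" "d x y \<le> \<rho> x y"
        using I S k by blast+
      have "e x y = e y x" using e S dd by (simp add: max.commute)
      moreover have "0 \<le> e x y" "e x y \<le> \<rho> x y" using e[OF S] dd by auto
      \<comment> \<open>A detour of value 0 forces \<open>x = k\<close> and \<open>k = y\<close>, so
        distinct points stay apart.\<close>
      moreover have "e x y = 0 \<longleftrightarrow> x = y" using e[OF S] dd by (auto simp: min_def max_def split: if_splits)
      ultimately show "e x y = e y x \<and> 0 \<le> e x y \<and> (e x y = 0 \<longleftrightarrow> x = y) \<and> e x y \<le> \<rho> x y \<and>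
        (x, y) \<in> (G (e x y))\<^sup>*" using path by blast
    qed
    show "?J (Suc k) e"
    proof (intro ballI impI)
      fix w x y assume S: "w \<in> S" "x \<in> S" "y \<in> S" and "w < Suc k"
      then consider "w = k" | "w < k" by linarith
      then show "e x y \<le> max (e x w) (e w y)"
      proof cases
        case 1
        then show ?thesis using e S k by auto
      next
        case 2
        \<comment> \<open>The cases are which of \<open>e x w\<close> and \<open>e w y\<close> use
          the detour through \<open>k\<close>. If neither does, the first inequality applies; if
          only \<open>e w y\<close> does, the second; if only \<open>e x w\<close> does, the third;
          if both do, the detour bounds \<open>e x y\<close> directly.\<close>
        then have "d x y \<le> max (d x w) (d w y)" "d x k \<le> max (d x w) (d w k)" "d k y \<le> max (d k w) (d w y)"
          using J S k by blast+
        then show ?thesis using e S k by (auto simp: min_le_iff_disj le_max_iff_disj)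
      qed
    qed
  qed
  have "case fold ?f [0..<n] (M, \<rho>, D) of (M', d, D') \<Rightarrow> M' = M \<and> D' = D \<and> ?I d \<and> ?J n d"
  proof (rule fold_upt_invariant[of "\<lambda>k (M', d, D'). M' = M \<and> D' = D \<and> ?I d \<and> ?J k d"], goal_cases)
    case 1
    then show ?case by (auto simp: S_def commute G_def r_into_rtrancl)
  next
    case (2 k a)
    then obtain d where a: "a = (M, d, D)" and I: "?I d" and J: "?J k d" by (cases a) auto
    obtain e where f: "?f k a = (M, e, D)"
      and e: "\<And>x y. x \<in> S \<Longrightarrow> y \<in> S \<Longrightarrow> e x y = (if k \<in> M then d x y else min (d x y) (max (d x k) (d k y)))"
      using relax_pairs_fold[OF 2(1), of M d D] unfolding a S_def by blast
    show ?case
    proof (cases "k \<in> M")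
      \<comment> \<open>A deleted pivot leaves the surviving distances alone, and
        \<open>?J (Suc k)\<close> asks nothing new because \<open>k\<close> is not in
        \<open>S\<close>.\<close>
      case True
      then have "?I e" using I e by simp
      moreover have "?J (Suc k) e" using J e True by (auto simp: S_def less_Suc_eq)
      ultimately show ?thesis unfolding f by simp
    next
      case False
      then have "?I e \<and> ?J (Suc k) e" using e 2(1) by (intro step[OF I J]) (auto simp: S_def)
      then show ?thesis unfolding f by blast
    qed
  qed
  moreover have "fold ?f [0..<n] (M, \<rho>, D) = fold relax_step (triples n) (M, \<rho>, D)"
    by (simp add: triples_def fold_product)
  ultimately obtain d where fold: "fold relax_step (triples n) (M, \<rho>, D) = (M, d, D)"
    and I: "?I d" and J: "?J n d"
    by (cases "fold relax_step (triples n) (M, \<rho>, D)") auto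
  have "\<forall>w\<in>S. \<forall>x\<in>S. \<forall>y\<in>S. d x y \<le> max (d x w) (d w y)" using J by (simp add: S_def)
  with I show ?thesis unfolding G_def by (intro that[OF fold]) blast+
qed

section \<open>Running time of programs\<close>

text \<open>An evaluator for code with branches but no loops. The value at \<open>While\<close> is a
  placeholder, which \<open>loop_free\<close> excludes.\<close>

fun exec :: "program \<Rightarrow> machine \<Rightarrow> machine" where
  "exec Skip s = s"
| "exec (Instr a) s = step a s"
| "exec (Seq P Q) s = exec Q (exec P s)"
| "exec (Cond b P Q) s = (if holds b s then exec P s else exec Q s)"
| "exec (While b P) s = s"

fun loop_free :: "program \<Rightarrow> bool" where
  "loop_free (Seq P Q) \<longleftrightarrow> loop_free P \<and> loop_free Q"
| "loop_free (Cond b P Q) \<longleftrightarrow> loop_free P \<and> loop_free Q"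
| "loop_free (While b P) \<longleftrightarrow> False"
| "loop_free _ \<longleftrightarrow> True"

fun steps :: "program \<Rightarrow> nat" where
  "steps Skip = 0"
| "steps (Instr a) = 1"
| "steps (Seq P Q) = steps P + steps Q"
| "steps (Cond b P Q) = Suc (max (steps P) (steps Q))"
| "steps (While b P) = 0"

text \<open>A total-correctness triple with time bound \<open>T\<close>: termination is
  included.\<close>

definition reaches :: "program \<Rightarrow> machine \<Rightarrow> nat \<Rightarrow> (machine \<Rightarrow> bool) \<Rightarrow> bool" where
  "reaches P s T Q \<longleftrightarrow> (\<exists>t s'. runs P s t s' \<and> t \<le> T \<and> Q s')"

lemma reaches_loop_free:
  assumes "loop_free P" "Q (exec P s)" "steps P \<le> T"
  shows "reaches P s T Q"
proof -
  have "\<exists>t. runs P s t (exec P s) \<and> t \<le> steps P"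
    using assms(1)
  proof (induction P arbitrary: s)
    case (Seq P1 P2)
    obtain t where t: "runs P1 s t (exec P1 s)" "t \<le> steps P1" using Seq by auto
    obtain u where u: "runs P2 (exec P1 s) u (exec P2 (exec P1 s))" "u \<le> steps P2" using Seq by auto
    show ?case using runs_Seq[OF t(1) u(1)] t(2) u(2) by (auto intro!: exI[of _ "t + u"])
  next
    case (Cond b P1 P2)
    show ?case
    proof (cases "holds b s")
      case True
      obtain t where "runs P1 s t (exec P1 s)" "t \<le> steps P1" using Cond by auto
      then show ?thesis using True by (auto intro!: exI[of _ "Suc t"] runs_Cond_True)
    next
      case False
      obtain t where "runs P2 s t (exec P2 s)" "t \<le> steps P2" using Cond by auto
      then show ?thesis using False by (auto intro!: exI[of _ "Suc t"] runs_Cond_False)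
    qed
  qed (auto intro: runs_Skip runs_Instr)
  then show ?thesis using assms(2,3) unfolding reaches_def by (meson order_trans)
qed

lemma reaches_Seq:
  assumes "reaches P s T R" "\<And>s'. R s' \<Longrightarrow> reaches Q s' U V"
  shows "reaches (Seq P Q) s (T + U) V"
  using assms unfolding reaches_def by (meson runs_Seq add_mono)

lemma reaches_mono: "reaches P s T Q \<Longrightarrow> T \<le> U \<Longrightarrow> (\<And>s. Q s \<Longrightarrow> R s) \<Longrightarrow> reaches P s U R"
  unfolding reaches_def by (meson order_trans)

text \<open>Natural numbers cannot be multiplied, so the loop maintains the row offset \<open>n * j\<close> in register \<open>m\<close>
  next to the counter \<open>j\<close> in register \<open>i\<close>. Registers 0 and 1 hold \<open>n\<close> and 1.\<close>

definition for_loop :: "nat \<Rightarrow> nat \<Rightarrow> program \<Rightarrow> program" where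
  "for_loop i m P = Seq (Seq (Instr (IConst i 0)) (Instr (IConst m 0)))
     (While (ILess i 0) (Seq P (Seq (Instr (IAdd i i 1)) (Instr (IAdd m m 0)))))"

text \<open>\<open>R\<close> relates machine states to abstract values, so a body implementing
  \<open>f j\<close> makes the loop implement the fold. Each round adds 3 for the test and two
  increments; the final 3 are the two initialisations and the failing test.\<close>

lemma reaches_for_loop:
  assumes body: "\<And>j s a. j < n \<Longrightarrow> ireg s i = j \<Longrightarrow> ireg s m = n * j \<Longrightarrow> R s a \<Longrightarrow>
      reaches P s T (\<lambda>s'. ireg s' i = j \<and> ireg s' m = n * j \<and> R s' (f j a))"
    and regs: "\<And>s a. R s a \<Longrightarrow> ireg s 0 = n \<and> ireg s 1 = 1"
    and frame: "\<And>s a l c. R s a \<Longrightarrow> l \<in> {i, m} \<Longrightarrow> R (s\<lparr>ireg := (ireg s)(l := c)\<rparr>) a"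
    and "i \<noteq> m" and "R s a"
  shows "reaches (for_loop i m P) s (n * (T + 3) + 3) (\<lambda>s'. R s' (fold f [0..<n] a))"
proof -
  let ?B = "Seq P (Seq (Instr (IAdd i i 1)) (Instr (IAdd m m 0)))"
  \<comment> \<open>If \<open>i\<close> were 0, \<open>frame\<close> would let register 0 become
    \<open>Suc n\<close>, against \<open>regs\<close>.\<close>
  have "i \<noteq> 0"
    using regs[OF frame[OF \<open>R s a\<close>, of i "Suc n"]] by (auto split: if_splits)
  have loop: "reaches (While (ILess i 0) ?B) s (k * (T + 3) + 1) (\<lambda>s'. R s' (fold f [j..<n] a))"
    if "k = n - j" "j \<le> n" "ireg s i = j" "ireg s m = n * j" "R s a" for k j s a
    using that
  proof (induction k arbitrary: j s a)
    case 0
    then have "\<not> holds (ILess i 0) s" using regs by simp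
    then show ?case using 0 unfolding reaches_def
      by (auto intro!: exI[of _ 1] exI[of _ s] runs_While_False)
  next
    case (Suc k)
    then have j: "j < n" by simp
    have inc: "reaches (Seq (Instr (IAdd i i 1)) (Instr (IAdd m m 0))) s 2
        (\<lambda>s'. ireg s' i = Suc j \<and> ireg s' m = n * Suc j \<and> R s' (f j a))"
      if s: "ireg s i = j \<and> ireg s m = n * j \<and> R s (f j a)" for s
    proof (rule reaches_loop_free)
      have "R (s\<lparr>ireg := (ireg s)(i := Suc j)\<rparr>) (f j a)" using frame[of s] s by blast
      from frame[OF this, of m "n * Suc j"] show
        "ireg (exec (Seq (Instr (IAdd i i 1)) (Instr (IAdd m m 0))) s) i = Suc j \<and>
         ireg (exec (Seq (Instr (IAdd i i 1)) (Instr (IAdd m m 0))) s) m = n * Suc j \<and>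
         R (exec (Seq (Instr (IAdd i i 1)) (Instr (IAdd m m 0))) s) (f j a)"
        using s regs[of s "f j a"] \<open>i \<noteq> m\<close> \<open>i \<noteq> 0\<close> by (simp add: add.commute)
    qed auto
    have "reaches ?B s (T + 2) (\<lambda>s'. ireg s' i = Suc j \<and> ireg s' m = n * Suc j \<and> R s' (f j a))"
      using Suc.prems by (intro reaches_Seq[OF body[OF j] inc]) auto
    then obtain t s' where t: "runs ?B s t s'" "t \<le> T + 2"
      and s': "ireg s' i = Suc j" "ireg s' m = n * Suc j" "R s' (f j a)"
      unfolding reaches_def by blast
    have "reaches (While (ILess i 0) ?B) s' (k * (T + 3) + 1) (\<lambda>s'. R s' (fold f [Suc j..<n] (f j a)))"
      using Suc.prems s' j by (intro Suc.IH) auto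
    then obtain u s'' where u: "runs (While (ILess i 0) ?B) s' u s''" "u \<le> k * (T + 3) + 1"
      and s'': "R s'' (fold f [Suc j..<n] (f j a))"
      unfolding reaches_def by blast
    have "holds (ILess i 0) s" using Suc.prems regs j by simp
    from runs_While_True[OF this t(1) u(1)] show ?case
      using t(2) u(2) s'' j unfolding reaches_def
      by (intro exI[of _ "Suc (t + u)"] exI[of _ s'']) (simp add: upt_conv_Cons)
  qed
  have "reaches (for_loop i m P) s (2 + (n * (T + 3) + 1)) (\<lambda>s'. R s' (fold f [0..<n] a))"
    unfolding for_loop_def
  proof (rule reaches_Seq)
    show "reaches (Seq (Instr (IConst i 0)) (Instr (IConst m 0))) s 2
        (\<lambda>s'. ireg s' i = 0 \<and> ireg s' m = 0 \<and> R s' a)"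
      using frame[OF frame[OF \<open>R s a\<close>, of i 0], of m 0] \<open>i \<noteq> m\<close> by (intro reaches_loop_free) auto
    show "reaches (While (ILess i 0) ?B) s' (n * (T + 3) + 1) (\<lambda>s'. R s' (fold f [0..<n] a))"
      if "ireg s' i = 0 \<and> ireg s' m = 0 \<and> R s' a" for s'
      using that by (intro loop) auto
  qed
  then show ?thesis by (rule reaches_mono) simp_all
qed

section \<open>The program\<close>

text \<open>Integer registers from 2 on are left free, so loop counters can change without affecting
  the relation. Register 1 keeps the increment 1.\<close>

definition represents :: "nat \<Rightarrow> real \<Rightarrow> machine \<Rightarrow> state \<Rightarrow> bool" where
  "represents n \<epsilon> s = (\<lambda>(M, d, D). ireg s 0 = n \<and> ireg s 1 = 1 \<and> rreg s 0 = \<epsilon> \<and> rreg s 4 = D \<and>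
     (\<forall>x<n. imem s x \<noteq> 0 \<longleftrightarrow> x \<in> M) \<and> (\<forall>x<n. \<forall>y<n. rmem s (n * x + y) = d x y))"

text \<open>The loops over \<open>z\<close>, \<open>x\<close>, \<open>y\<close> keep their counters in registers 2, 4, 6 and the row offsets in
  registers 3, 5, 7.\<close>

definition loop3 :: "program \<Rightarrow> program" where
  "loop3 P = for_loop 2 3 (for_loop 4 5 (for_loop 6 7 P))"

definition block :: "instr list \<Rightarrow> program" where
  "block is = foldr (\<lambda>a. Seq (Instr a)) is Skip"

text \<open>Real registers 1, 2, 3 receive the distances of \<open>xy\<close>, \<open>xz\<close>, \<open>zy\<close>; register 11 becomes 0 iff
  none of the three points is an outlier.\<close>

definition load :: program where
  "load = block [IAdd 8 5 6, IAdd 9 5 2, IAdd 10 3 6, RLoad 1 8, RLoad 2 9, RLoad 3 10,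
     ILoad 11 4, ILoad 12 6, ILoad 13 2, IAdd 11 11 12, IAdd 11 11 13]"

text \<open>Adding the constant 0 acts as a copy from real register 1 to real register 4.\<close>

definition diam_body :: program where
  "diam_body = Seq load (Cond (RLess 4 1) (block [RConst 5 0, RAdd 4 1 5]) Skip)"

text \<open>Integer register 1 holds 1, so \<open>ILess 11 1\<close> tests for 0 and the stores
  write the mark 1 at the addresses \<open>x\<close>, \<open>y\<close>, \<open>z\<close>.\<close>

definition mark_body :: program where
  "mark_body = Seq load (Seq (block [RAdd 5 2 4, RAdd 6 3 4])
     (Cond (ILess 11 1) (Cond (RLess 5 1) (Cond (RLess 6 1)
       (block [IStore 4 1, IStore 6 1, IStore 2 1]) Skip) Skip) Skip))"

definition relax_body :: program where
  "relax_body = Seq load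
     (Cond (ILess 11 1) (Cond (RLess 2 1) (Cond (RLess 3 1)
       (Cond (RLess 2 3) (Instr (RStore 8 3)) (Instr (RStore 8 2))) Skip) Skip) Skip)"

section \<open>Effect and cost of the three passes\<close>

definition at_triple :: "nat \<Rightarrow> nat \<times> nat \<times> nat \<Rightarrow> machine \<Rightarrow> bool" where
  "at_triple n = (\<lambda>(z, x, y) s. ireg s 2 = z \<and> ireg s 3 = n * z \<and> ireg s 4 = x \<and> ireg s 5 = n * x \<and>
     ireg s 6 = y \<and> ireg s 7 = n * y)"

lemma reaches_loop3:
  assumes body: "\<And>p s a. p \<in> set (triples n) \<Longrightarrow> at_triple n p s \<Longrightarrow> represents n \<epsilon> s a \<Longrightarrow>
      reaches P s T (\<lambda>s'. at_triple n p s' \<and> represents n \<epsilon> s' (f p a))"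
    and "represents n \<epsilon> s a"
  shows "reaches (loop3 P) s (n * (n * (n * (T + 3) + 6) + 6) + 3)
    (\<lambda>s'. represents n \<epsilon> s' (fold f (triples n) a))"
proof -
  have frame: "represents n \<epsilon> (s\<lparr>ireg := (ireg s)(l := c)\<rparr>) a" if "represents n \<epsilon> s a" "l \<ge> 2" for s a l c
    using that by (auto simp: represents_def)
  have regs: "ireg s 0 = n \<and> ireg s 1 = 1" if "represents n \<epsilon> s a" for s a
    using that by (auto simp: represents_def)
  \<comment> \<open>The inner relations carry the outer counters and offsets, which the inner loops
    must preserve.\<close>
  let ?R1 = "\<lambda>z s a. represents n \<epsilon> s a \<and> ireg s 2 = z \<and> ireg s 3 = n * z"
  let ?R2 = "\<lambda>z x s a. ?R1 z s a \<and> ireg s 4 = x \<and> ireg s 5 = n * x"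
  have loop1: "reaches (for_loop 6 7 P) s (n * (T + 3) + 3) (\<lambda>s'. ?R2 z x s' (fold (\<lambda>y. f (z, x, y)) [0..<n] a))"
    if "z < n" "x < n" "?R2 z x s a" for z x s a
  proof (rule reaches_for_loop)
    fix j s a assume "j < n" "ireg s 6 = j" "ireg s 7 = n * j" "?R2 z x s a"
    then show "reaches P s T (\<lambda>s'. ireg s' 6 = j \<and> ireg s' 7 = n * j \<and> ?R2 z x s' (f (z, x, j) a))"
      using \<open>z < n\<close> \<open>x < n\<close>
      by (intro reaches_mono[OF body[of "(z, x, j)" s a]]) (auto simp: set_triples at_triple_def)
  qed (use that regs frame in auto)
  have loop2: "reaches (for_loop 4 5 (for_loop 6 7 P)) s (n * (n * (T + 3) + 3 + 3) + 3)
      (\<lambda>s'. ?R1 z s' (fold (\<lambda>x. fold (\<lambda>y. f (z, x, y)) [0..<n]) [0..<n] a))"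
    if "z < n" "?R1 z s a" for z s a
  proof (rule reaches_for_loop)
    fix j s a assume "j < n" "ireg s 4 = j" "ireg s 5 = n * j" "?R1 z s a"
    then show "reaches (for_loop 6 7 P) s (n * (T + 3) + 3)
        (\<lambda>s'. ireg s' 4 = j \<and> ireg s' 5 = n * j \<and> ?R1 z s' (fold (\<lambda>y. f (z, j, y)) [0..<n] a))"
      using \<open>z < n\<close> by (intro reaches_mono[OF loop1[of z j s a]]) auto
  qed (use that regs frame in auto)
  have "reaches (loop3 P) s (n * (n * (n * (T + 3) + 3 + 3) + 3 + 3) + 3)
      (\<lambda>s'. represents n \<epsilon> s' (fold (\<lambda>z. fold (\<lambda>x. fold (\<lambda>y. f (z, x, y)) [0..<n]) [0..<n]) [0..<n] a))"
    unfolding loop3_def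
  proof (rule reaches_for_loop)
    fix j s a assume "j < n" "ireg s 2 = j" "ireg s 3 = n * j" "represents n \<epsilon> s a"
    then show "reaches (for_loop 4 5 (for_loop 6 7 P)) s (n * (n * (T + 3) + 3 + 3) + 3)
        (\<lambda>s'. ireg s' 2 = j \<and> ireg s' 3 = n * j \<and>
          represents n \<epsilon> s' (fold (\<lambda>x. fold (\<lambda>y. f (j, x, y)) [0..<n]) [0..<n] a))"
      by (intro reaches_mono[OF loop2[of j s a]]) auto
  qed (use assms(2) regs frame in auto)
  then show ?thesis by (rule reaches_mono) (simp_all add: fold_triples)
qed

lemma exec_load:
  assumes "(z, x, y) \<in> set (triples n)" "at_triple n (z, x, y) s" "represents n \<epsilon> s (M, d, D)"
  obtains s' where "exec load s = s'" "at_triple n (z, x, y) s'" "represents n \<epsilon> s' (M, d, D)"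
    "rreg s' 1 = d x y" "rreg s' 2 = d x z" "rreg s' 3 = d z y" "ireg s' 8 = n * x + y"
    "ireg s' 11 = 0 \<longleftrightarrow> x \<notin> M \<and> y \<notin> M \<and> z \<notin> M"
proof (rule that[OF refl])
  have load: "exec load s = s\<lparr>ireg := (ireg s)(8 := n * x + y, 9 := n * x + z, 10 := n * z + y,
      12 := imem s y, 13 := imem s z, 11 := imem s x + imem s y + imem s z),
      rreg := (rreg s)(1 := d x y, 2 := d x z, 3 := d z y)\<rparr>"
    using assms by (simp add: load_def block_def at_triple_def represents_def set_triples fun_upd_twist)
  show "at_triple n (z, x, y) (exec load s)" "represents n \<epsilon> (exec load s) (M, d, D)"
    using assms by (simp_all add: load at_triple_def represents_def)
  show "ireg (exec load s) 11 = 0 \<longleftrightarrow> x \<notin> M \<and> y \<notin> M \<and> z \<notin> M"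
    using assms by (auto simp: load represents_def set_triples)
qed (use assms in \<open>simp_all add: load_def block_def at_triple_def represents_def set_triples\<close>)

text \<open>20 is a common bound for the three bodies: \<open>load\<close> takes 11 steps, and the
  longest body, \<open>mark_body\<close>, at most 19.\<close>

lemma diam_body:
  assumes "p \<in> set (triples n)" "at_triple n p s" "represents n \<epsilon> s a"
  shows "reaches diam_body s 20 (\<lambda>s'. at_triple n p s' \<and> represents n \<epsilon> s' (diam_step p a))"
proof -
  obtain z x y where p: "p = (z, x, y)" by (cases p)
  obtain M d D where a: "a = (M, d, D)" by (cases a)
  from assms obtain s' where "exec load s = s'" "at_triple n p s'" "represents n \<epsilon> s' a" "rreg s' 1 = d x y"
    unfolding p a by (rule exec_load)
  then have "at_triple n p (exec diam_body s) \<and> represents n \<epsilon> (exec diam_body s) (diam_step p a)"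
    by (simp add: p a diam_body_def block_def at_triple_def represents_def)
  then show ?thesis
    by (rule reaches_loop_free[rotated]) (simp_all add: diam_body_def load_def block_def)
qed

lemma mark_body:
  assumes "p \<in> set (triples n)" "at_triple n p s" "represents n \<epsilon> s a"
  shows "reaches mark_body s 20 (\<lambda>s'. at_triple n p s' \<and> represents n \<epsilon> s' (mark_step p a))"
proof -
  obtain z x y where p: "p = (z, x, y)" by (cases p)
  obtain M d D where a: "a = (M, d, D)" by (cases a)
  from assms obtain s' where s': "exec load s = s'" "at_triple n p s'" "represents n \<epsilon> s' a"
    "rreg s' 1 = d x y" "rreg s' 2 = d x z" "rreg s' 3 = d z y"
    "ireg s' 11 = 0 \<longleftrightarrow> x \<notin> M \<and> y \<notin> M \<and> z \<notin> M"
    unfolding p a by (rule exec_load)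
  have "at_triple n p (exec mark_body s) \<and> represents n \<epsilon> (exec mark_body s) (mark_step p a)"
  proof (cases "x \<notin> M \<and> y \<notin> M \<and> z \<notin> M \<and> d x z + D < d x y \<and> d z y + D < d x y")
    case True
    with s' show ?thesis
      by (simp add: p a mark_body_def block_def at_triple_def represents_def)
  next
    case False
    with s' show ?thesis
      by (auto simp: p a mark_body_def block_def at_triple_def represents_def)
  qed
  then show ?thesis
    by (rule reaches_loop_free[rotated]) (simp_all add: mark_body_def load_def block_def)
qed

text \<open>Division by \<open>n\<close> recovers the row. Hence a store at one pair changes no
  other entry of the matrix.\<close>

lemma row_index_eq_iff:
  fixes n :: nat
  assumes "y < n" "y' < n"
  shows "n * x + y = n * x' + y' \<longleftrightarrow> x = x' \<and> y = y'"
proof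
  assume eq: "n * x + y = n * x' + y'"
  have "x = x'" using arg_cong[OF eq, of "\<lambda>i. i div n"] assms by simp
  then show "x = x' \<and> y = y'" using eq by simp
qed simp

lemma relax_body:
  assumes "p \<in> set (triples n)" "at_triple n p s" "represents n \<epsilon> s a"
  shows "reaches relax_body s 20 (\<lambda>s'. at_triple n p s' \<and> represents n \<epsilon> s' (relax_step p a))"
proof -
  obtain z x y where p: "p = (z, x, y)" by (cases p)
  obtain M d D where a: "a = (M, d, D)" by (cases a)
  from assms obtain s' where s': "exec load s = s'" "at_triple n p s'" "represents n \<epsilon> s' a"
    "rreg s' 1 = d x y" "rreg s' 2 = d x z" "rreg s' 3 = d z y" "ireg s' 8 = n * x + y"
    "ireg s' 11 = 0 \<longleftrightarrow> x \<notin> M \<and> y \<notin> M \<and> z \<notin> M"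
    unfolding p a by (rule exec_load)
  have "x < n" "y < n" using assms(1) by (auto simp: p set_triples)
  have "at_triple n p (exec relax_body s) \<and> represents n \<epsilon> (exec relax_body s) (relax_step p a)"
  \<comment> \<open>Outside this case the minimum keeps \<open>d x y\<close>, and after
    \<open>load\<close> neither the machine nor the abstract state changes.\<close>
  proof (cases "x \<notin> M \<and> y \<notin> M \<and> z \<notin> M \<and> d x z < d x y \<and> d z y < d x y")
    case True
    with s' \<open>x < n\<close> \<open>y < n\<close> show ?thesis
      by (simp add: p a relax_body_def at_triple_def represents_def row_index_eq_iff)
  next
    case False
    moreover have "ireg s' 1 = 1" using s'(3) by (simp add: a represents_def)
    ultimately have "exec relax_body s = s'" using s' by (auto simp: relax_body_def)
    moreover have "relax_step p a = a" using False by (auto simp: p a fun_eq_iff)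
    ultimately show ?thesis using s' by simp
  qed
  then show ?thesis
    by (rule reaches_loop_free[rotated]) (simp_all add: relax_body_def load_def block_def)
qed

text \<open>Register 1 receives the increment 1 in place of \<open>k\<close>. Real register 4 holds
  the diameter after the first pass and is then turned into the threshold \<open>D\<close>.\<close>

definition main :: program where
  "main = Seq (Instr (IConst 1 1)) (Seq (loop3 diam_body) (Seq (block [RConst 5 2, RMul 4 4 5, RMul 4 4 0])
     (Seq (loop3 mark_body) (loop3 relax_body))))"

lemma main_reaches:
  assumes "Metric_space {..<n} \<rho>" "n \<ge> 1"
  shows "reaches main (input_state n \<rho> \<epsilon> k) (3 * (n * (n * (n * 23 + 6) + 6) + 3) + 4)
    (\<lambda>s. represents n \<epsilon> s (fold relax_step (triples n)
      (fold mark_step (triples n) ({}, \<rho>, 2 * \<epsilon> * finite_diam {..<n} \<rho>))))"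
proof -
  let ?T = "n * (n * (n * (20 + 3) + 6) + 6) + 3"
  have init: "reaches (Instr (IConst 1 1)) (input_state n \<rho> \<epsilon> k) 1 (\<lambda>s. represents n \<epsilon> s ({}, \<rho>, 0))"
  proof (rule reaches_loop_free)
    have "n * x + y < n * n" if "x < n" "y < n" for x y
    proof -
      have "n * x + y < n * Suc x" using that by simp
      also have "\<dots> \<le> n * n" using that by (intro mult_le_mono) auto
      finally show ?thesis .
    qed
    then show "represents n \<epsilon> (exec (Instr (IConst 1 1)) (input_state n \<rho> \<epsilon> k)) ({}, \<rho>, 0)"
      by (auto simp: represents_def input_state_def)
  qed auto
  have threshold: "reaches (block [RConst 5 2, RMul 4 4 5, RMul 4 4 0]) s 3
      (\<lambda>s'. represents n \<epsilon> s' ({}, \<rho>, 2 * \<epsilon> * finite_diam {..<n} \<rho>))"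
    if "represents n \<epsilon> s ({}, \<rho>, finite_diam {..<n} \<rho>)" for s
    using that by (intro reaches_loop_free) (auto simp: block_def represents_def)
  \<comment> \<open>Each pass takes at most \<open>?T\<close> steps; 1 is the first instruction and
    3 the computation of the threshold.\<close>
  have "reaches main (input_state n \<rho> \<epsilon> k) (1 + (?T + (3 + (?T + ?T))))
    (\<lambda>s. represents n \<epsilon> s (fold relax_step (triples n)
      (fold mark_step (triples n) ({}, \<rho>, 2 * \<epsilon> * finite_diam {..<n} \<rho>))))"
    unfolding main_def
    apply (rule reaches_Seq[OF init])
    apply (rule reaches_Seq[OF reaches_loop3[OF diam_body]], assumption+)
    apply (rule reaches_Seq[OF threshold], simp add: diam_fold[OF assms])
    apply (rule reaches_Seq[OF reaches_loop3[OF mark_body]], assumption+)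
    apply (rule reaches_loop3[OF relax_body], assumption+)
    done
  then show ?thesis by (rule reaches_mono) auto
qed

section \<open>Correctness of the output\<close>

lemma admits_almost_ultrametric:
  assumes "admits_outlier_embedding_ultrametric X \<rho> \<epsilon> k"
  obtains S where "S \<subseteq> X" "card S \<le> k"
    and "\<And>x y z. x \<in> X - S \<Longrightarrow> y \<in> X - S \<Longrightarrow> z \<in> X - S \<Longrightarrow>
      \<rho> x y \<le> max (\<rho> x z) (\<rho> z y) + 2 * \<epsilon> * finite_diam X \<rho>"
proof -
  obtain S and Y :: "nat set" and \<rho>' f where Y: "ultrametric_space Y \<rho>'"
    and emb: "outlier_embedding X \<rho> \<epsilon> k S Y \<rho>' f"
    using assms unfolding admits_outlier_embedding_ultrametric_def by blast
  show ?thesis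
  proof (rule that)
    fix x y z assume xyz: "x \<in> X - S" "y \<in> X - S" "z \<in> X - S"
    then have "f x \<in> Y" "f y \<in> Y" "f z \<in> Y" using emb by (auto simp: outlier_embedding_def)
    then have "\<rho>' (f x) (f y) \<le> max (\<rho>' (f x) (f z)) (\<rho>' (f z) (f y))"
      using Y by (auto simp: ultrametric_space_def)
    \<comment> \<open>The embedding error enters once on each side of the inequality, hence the
      factor 2.\<close>
    moreover have "\<bar>\<rho> u v - \<rho>' (f u) (f v)\<bar> \<le> \<epsilon> * finite_diam X \<rho>" if "u \<in> X - S" "v \<in> X - S" for u v
      using emb that by (auto simp: outlier_embedding_def)
    note this[OF xyz(1,2)] this[OF xyz(1,3)] this[OF xyz(3,2)]
    ultimately show "\<rho> x y \<le> max (\<rho> x z) (\<rho> z y) + 2 * \<epsilon> * finite_diam X \<rho>" by linarith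
  qed (use emb in \<open>auto simp: outlier_embedding_def\<close>)
qed

text \<open>The embedding behind \<open>adm\<close> is never computed; it enters only through the
  set \<open>S\<close> that bounds the number of deletions.\<close>

lemma final_state_correct:
  assumes metric: "Metric_space {..<n} \<rho>" and "n \<ge> 1" "\<epsilon> \<ge> 0"
    and s: "represents n \<epsilon> s (fold relax_step (triples n)
      (fold mark_step (triples n) ({}, \<rho>, 2 * \<epsilon> * finite_diam {..<n} \<rho>)))"
    and adm: "admits_outlier_embedding_ultrametric {..<n} \<rho> \<epsilon> k"
  shows "ultrametric_space ({..<n} - output_outliers n s) (output_dist n s)"
    and "outlier_embedding {..<n} \<rho> (8 / ln 2 * \<epsilon> * ln (real n)) (3 * k)
      (output_outliers n s) ({..<n} - output_outliers n s) (output_dist n s) id"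
proof -
  interpret Metric_space "{..<n}" \<rho> by fact
  define D where "D = 2 * \<epsilon> * finite_diam {..<n} \<rho>"
  have "\<rho> 0 0 \<le> finite_diam {..<n} \<rho>"
    using \<open>n \<ge> 1\<close> by (intro le_finite_diam) auto
  then have D: "D \<ge> 0" using \<open>\<epsilon> \<ge> 0\<close> order_trans[OF nonneg[of 0 0]] by (simp add: D_def)
  obtain S where S: "S \<subseteq> {..<n}" "card S \<le> k"
    and "\<And>x y z. x \<in> {..<n} - S \<Longrightarrow> y \<in> {..<n} - S \<Longrightarrow> z \<in> {..<n} - S \<Longrightarrow>
      \<rho> x y \<le> max (\<rho> x z) (\<rho> z y) + D"
    using admits_almost_ultrametric[OF adm] unfolding D_def by blast
  from mark_fold[where \<rho> = \<rho> and D = D, OF S(1) this(3)] obtain M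
    where M: "fold mark_step (triples n) ({}, \<rho>, D) = (M, \<rho>, D)" "M \<subseteq> {..<n}" "card M \<le> 3 * card S"
    and almost: "\<And>x y z. x \<in> {..<n} - M \<Longrightarrow> y \<in> {..<n} - M \<Longrightarrow> z \<in> {..<n} - M \<Longrightarrow>
      \<rho> x y \<le> max (\<rho> x z) (\<rho> z y) + D" by blast
  define X where "X = {..<n} - M"
  obtain d where d: "fold relax_step (triples n) (M, \<rho>, D) = (M, d, D)"
    and sym: "\<And>x y. x \<in> X \<Longrightarrow> y \<in> X \<Longrightarrow> d x y = d y x"
    and d_nonneg: "\<And>x y. x \<in> X \<Longrightarrow> y \<in> X \<Longrightarrow> 0 \<le> d x y"
    and d_zero: "\<And>x y. x \<in> X \<Longrightarrow> y \<in> X \<Longrightarrow> d x y = 0 \<longleftrightarrow> x = y"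
    and le: "\<And>x y. x \<in> X \<Longrightarrow> y \<in> X \<Longrightarrow> d x y \<le> \<rho> x y"
    and path: "\<And>x y. x \<in> X \<Longrightarrow> y \<in> X \<Longrightarrow> (x, y) \<in> {(u, v) \<in> X \<times> X. \<rho> u v \<le> d x y}\<^sup>*"
    and ultra: "\<And>x y z. x \<in> X \<Longrightarrow> y \<in> X \<Longrightarrow> z \<in> X \<Longrightarrow> d x y \<le> max (d x z) (d z y)"
    using relax_fold[OF metric, of M D] unfolding X_def by blast
  have rep: "represents n \<epsilon> s (M, d, D)" using s by (simp flip: D_def add: M(1) d)
  have out: "output_outliers n s = M" using rep M(2) by (auto simp: output_outliers_def represents_def)
  have dist: "output_dist n s x y = (if x \<in> X \<and> y \<in> X then d x y else 0)" for x y
    using rep by (auto simp: output_dist_def out represents_def X_def)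
  have "Metric_space X (output_dist n s)"
  proof
    fix x y z
    show "0 \<le> output_dist n s x y" "output_dist n s x y = output_dist n s y x"
      using d_nonneg sym by (auto simp: dist)
    show "output_dist n s x y = 0 \<longleftrightarrow> x = y" if "x \<in> X" "y \<in> X"
      using that d_zero by (simp add: dist)
    show "output_dist n s x z \<le> output_dist n s x y + output_dist n s y z" if "x \<in> X" "y \<in> X" "z \<in> X"
      using that ultra[of x z y] d_nonneg[of x y] d_nonneg[of y z] by (simp add: dist)
  qed
  then show "ultrametric_space ({..<n} - output_outliers n s) (output_dist n s)"
    using ultra by (simp add: ultrametric_space_def out dist flip: X_def)
  have "\<bar>\<rho> x y - d x y\<bar> \<le> 8 / ln 2 * \<epsilon> * ln (real n) * finite_diam {..<n} \<rho>"
    if xy: "x \<in> X" "y \<in> X" for x y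
  proof -
    \<comment> \<open>\<open>d \<le> \<rho>\<close> settles one side of the distortion; the minimax
      path gives the other.\<close>
    have "\<rho> x y \<le> d x y + 4 * log 2 (real n) * D"
    proof (rule rtrancl_almost_ultrametric[where S = X])
      show "\<rho> u u \<le> d x y" if "u \<in> X" for u using d_nonneg[OF xy] that by (simp add: X_def)
      show "card X \<le> n" using card_mono[of "{..<n}" X] by (auto simp: X_def)
    qed (use almost D \<open>n \<ge> 1\<close> path xy in \<open>auto simp: X_def\<close>)
    \<comment> \<open>The constant 8 is 4 times the factor 2 in \<open>D\<close>, and
      \<open>1 / ln 2\<close> is the change of base.\<close>
    moreover have "4 * log 2 (real n) * D = 8 / ln 2 * \<epsilon> * ln (real n) * finite_diam {..<n} \<rho>"
      by (simp add: D_def log_def)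
    ultimately show ?thesis using le[OF xy] by linarith
  qed
  then show "outlier_embedding {..<n} \<rho> (8 / ln 2 * \<epsilon> * ln (real n)) (3 * k)
      (output_outliers n s) ({..<n} - output_outliers n s) (output_dist n s) id"
    using M S(2) by (auto simp: outlier_embedding_def out dist simp flip: X_def)
qed

theorem theorem17:
  shows "\<exists>C::real. C > 0 \<and> (\<exists>(P::program) (p::nat poly).
    \<forall>(n::nat) (\<rho>::nat \<Rightarrow> nat \<Rightarrow> real) (\<epsilon>::real) (k::nat).
      n \<ge> 1 \<longrightarrow> Metric_space {..<n} \<rho> \<longrightarrow> \<epsilon> \<ge> 0 \<longrightarrow>
      (\<exists>t s. runs P (input_state n \<rho> \<epsilon> k) t s \<and> t \<le> poly p n \<and>
        (admits_outlier_embedding_ultrametric {..<n} \<rho> \<epsilon> k \<longrightarrow>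
          ultrametric_space ({..<n} - output_outliers n s) (output_dist n s) \<and>
          outlier_embedding {..<n} \<rho> (C * \<epsilon> * ln (real n)) (3 * k)
            (output_outliers n s) ({..<n} - output_outliers n s) (output_dist n s) id)))"
\<comment> \<open>The coefficients come from multiplying out the step bound of
  \<open>main_reaches\<close>.\<close>
proof (intro exI[of _ "8 / ln 2"] conjI exI[of _ main] exI[of _ "[:13, 18, 18, 69:]"] allI impI)
  fix n :: nat and \<rho> :: "nat \<Rightarrow> nat \<Rightarrow> real" and \<epsilon> :: real and k :: nat
  assume n: "n \<ge> 1" and metric: "Metric_space {..<n} \<rho>" and "\<epsilon> \<ge> 0"
  have "poly [:13, 18, 18, 69:] n = 3 * (n * (n * (n * 23 + 6) + 6) + 3) + 4"
    by (simp add: algebra_simps)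
  with main_reaches[OF metric n, of \<epsilon> k] final_state_correct[OF metric n \<open>\<epsilon> \<ge> 0\<close>]
  show "\<exists>t s. runs main (input_state n \<rho> \<epsilon> k) t s \<and> t \<le> poly [:13, 18, 18, 69:] n \<and>
        (admits_outlier_embedding_ultrametric {..<n} \<rho> \<epsilon> k \<longrightarrow>
          ultrametric_space ({..<n} - output_outliers n s) (output_dist n s) \<and>
          outlier_embedding {..<n} \<rho> (8 / ln 2 * \<epsilon> * ln (real n)) (3 * k)
            (output_outliers n s) ({..<n} - output_outliers n s) (output_dist n s) id)"
    unfolding reaches_def by metis
qed simp

end
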